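(* For every integer $L\ge1$ there exists a polynomial $p(x,y,z)\in\mathbb{C}[x,y,z]$ such that $p$ has no zeros in $\mathbb{H}^3$, the only zero of $p$ in $\overline{\mathbb{H}^3}$ is $(0,0,0)$, $\frac{\partial p}{\partial z}(0)\neq0$, and the associated function $\phi$, determined by $p(x,y,z)=u(x,y,z)(z+\phi(x,y))$ near $0$ with $\phi\in\mathbb{C}\{x,y\}$, $\phi(0)=0$, $u\in\mathbb{C}\{x,y,z\}$, $u(0)\ne0$, is such that $\operatorname{Im}\phi$ vanishes to order $2L$ at $0$ with $\operatorname{Im}\phi_{2L}$ positive definite.
   Context: $\mathbb{H}=\{z\in\mathbb{C}:\operatorname{Im}z>0\}$ and $\overline{\mathbb{H}^3}$ is the closure of $\mathbb{H}^3$ in $\mathbb{C}^3$. $\mathbb{C}\{\cdot\}$ denotes the ring of power series in the given variables convergent in a neighborhood of $0$. Since $\frac{\partial p}{\partial z}(0)\ne0$ and $p(0)=0$, the factorization $p=u\cdot(z+\phi)$ exists with $\phi$ unique, by the Weierstrass preparation theorem. $\phi=\sum_{j\ge1}\phi_j$ is the expansion of $\phi$ into homogeneous polynomials $\phi_j$ of degree $j$. For a power series $f$, $\operatorname{Im}f$ is obtained by taking imaginary parts of the coefficients. $\operatorname{Im}\phi$ vanishing to order $2L$ means $\operatorname{Im}\phi_j\equiv0$ for $j<2L$ and $\operatorname{Im}\phi_{2L}\not\equiv0$; "positive definite" means strictly positive on $\{(x,y)\in\mathbb{R}^2:x^2+y^2=1\}$. *)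

theory Defs
  imports "HOL-Analysis.Analysis" "HOL-Computational_Algebra.Computational_Algebra"
begin

definition upper_half_plane :: "complex set" where
  "upper_half_plane = {z. Im z > 0}"

definition upper_half_space3 :: "(complex \<times> complex \<times> complex) set" where
  "upper_half_space3 = upper_half_plane \<times> upper_half_plane \<times> upper_half_plane"

text \<open>
  The rings \<open>R[x,y]\<close>, \<open>R[x,y,z]\<close>, \<open>R[[x,y]]\<close>, \<open>R[[x,y,z]]\<close> are iterated as \<open>R[x][y]\<close>, \<open>R[x][y][z]\<close>,
  \<open>R[[x]][[y]]\<close>, \<open>R[[x]][[y]][[z]]\<close>: the last variable is the outermost one, and the
  coefficient of \<open>x^i y^j z^k\<close> is obtained by taking the \<open>k\<close>-th, then the \<open>j\<close>-th, then the
  \<open>i\<close>-th coefficient. In particular \<^const>\<open>pderiv\<close> on \<open>R[x][y][z]\<close> is the partial derivative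
  with respect to \<open>z\<close>.
\<close>

definition poly2 :: "'a::comm_ring_1 poly poly \<Rightarrow> 'a \<Rightarrow> 'a \<Rightarrow> 'a" where
  "poly2 q x y = poly (poly q [:y:]) x"

definition poly3 :: "'a::comm_ring_1 poly poly poly \<Rightarrow> 'a \<Rightarrow> 'a \<Rightarrow> 'a \<Rightarrow> 'a" where
  "poly3 p x y z = poly (poly (poly p [:[:z:]:]) [:y:]) x"

definition fps2_nth :: "'a fps fps \<Rightarrow> nat \<Rightarrow> nat \<Rightarrow> 'a" where
  "fps2_nth f i j = fps_nth (fps_nth f j) i"

definition fps3_nth :: "'a fps fps fps \<Rightarrow> nat \<Rightarrow> nat \<Rightarrow> nat \<Rightarrow> 'a" where
  "fps3_nth f i j k = fps_nth (fps_nth (fps_nth f k) j) i"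

definition fps2_term :: "complex fps fps \<Rightarrow> complex \<Rightarrow> complex \<Rightarrow> nat \<times> nat \<Rightarrow> complex" where
  "fps2_term f x y = (\<lambda>(i, j). fps2_nth f i j * x ^ i * y ^ j)"

definition fps3_term ::
  "complex fps fps fps \<Rightarrow> complex \<Rightarrow> complex \<Rightarrow> complex \<Rightarrow> nat \<times> nat \<times> nat \<Rightarrow> complex" where
  "fps3_term f x y z = (\<lambda>(i, j, k). fps3_nth f i j k * x ^ i * y ^ j * z ^ k)"

text \<open>
  \<^const>\<open>summable_on\<close> is unconditional, hence absolute convergence of the family of all
  monomials, so these are the rings \<open>C{x,y}\<close> and \<open>C{x,y,z}\<close>.
\<close>

definition conv_fps2 :: "complex fps fps set" where
  "conv_fps2 = {f. \<forall>\<^sub>F (x, y) in nhds (0, 0). fps2_term f x y summable_on UNIV}"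

definition conv_fps3 :: "complex fps fps fps set" where
  "conv_fps3 = {f. \<forall>\<^sub>F (x, y, z) in nhds (0, 0, 0). fps3_term f x y z summable_on UNIV}"

definition eval_fps2 :: "complex fps fps \<Rightarrow> complex \<Rightarrow> complex \<Rightarrow> complex" where
  "eval_fps2 f x y = infsum (fps2_term f x y) UNIV"

definition eval_fps3 :: "complex fps fps fps \<Rightarrow> complex \<Rightarrow> complex \<Rightarrow> complex \<Rightarrow> complex" where
  "eval_fps3 f x y z = infsum (fps3_term f x y z) UNIV"

definition associated_series :: "complex poly poly poly \<Rightarrow> complex fps fps \<Rightarrow> bool" where
  "associated_series p \<phi> \<longleftrightarrow>
     \<phi> \<in> conv_fps2 \<and> fps2_nth \<phi> 0 0 = 0 \<and>
     (\<exists>u\<in>conv_fps3. fps3_nth u 0 0 0 \<noteq> 0 \<and>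
        (\<forall>\<^sub>F (x, y, z) in nhds (0, 0, 0).
           poly3 p x y z = eval_fps3 u x y z * (z + eval_fps2 \<phi> x y)))"

definition Im_fps2 :: "complex fps fps \<Rightarrow> real fps fps" where
  "Im_fps2 f = Abs_fps (\<lambda>j. Abs_fps (\<lambda>i. Im (fps2_nth f i j)))"

definition homogeneous_part :: "'a::comm_ring_1 fps fps \<Rightarrow> nat \<Rightarrow> 'a poly poly" where
  "homogeneous_part f d = (\<Sum>i\<le>d. monom (monom (fps2_nth f i (d - i)) i) (d - i))"

definition vanishes_to_order :: "'a::comm_ring_1 fps fps \<Rightarrow> nat \<Rightarrow> bool" where
  "vanishes_to_order f n \<longleftrightarrow>
     (\<forall>d<n. homogeneous_part f d = 0) \<and> homogeneous_part f n \<noteq> 0"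

definition positive_definite :: "real poly poly \<Rightarrow> bool" where
  "positive_definite q \<longleftrightarrow> (\<forall>x y. x\<^sup>2 + y\<^sup>2 = 1 \<longrightarrow> poly2 q x y > 0)"

end

theory Submission
  imports Defs
begin

text \<open>
  The variables separate. Suppose \<open>f = N/D\<close> is a rational function of one variable without
  poles in the closed upper half plane, with \<open>f(0) = 0\<close> and \<open>Im f(x) > 0\<close> for every \<open>x \<noteq> 0\<close>
  with \<open>Im x \<ge> 0\<close>, and put
  \<open>p(x,y,z) = D(x) D(y) (z + f(x) + f(y))\<close>.
  At a zero with \<open>Im x, Im y, Im z \<ge> 0\<close> the three nonnegative numbers \<open>Im z\<close>, \<open>Im f(x)\<close>,
  \<open>Im f(y)\<close> add up to zero, so \<open>x = y = 0\<close> and then \<open>z = 0\<close>. The displayed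
  factorization already has the required form with \<open>u = D(x) D(y)\<close> and \<open>\<phi> = f(x) + f(y)\<close>,
  and if \<open>Im f\<close> begins with \<open>x^(2L)\<close> then \<open>Im \<phi>\<close> begins with the positive definite form
  \<open>x^(2L) + y^(2L)\<close>. Everything is thus reduced to one variable.

  A suitable \<open>f = f_L\<close> comes from the continued fraction \<open>f_0 = i\<close>,
  \<open>f_(n+1) = x / (1 - x f_n)\<close>. Since \<open>-1/f_(n+1) = -1/x + f_n\<close>, positivity of the imaginary part
  passes from \<open>f_n\<close> to \<open>f_(n+1)\<close> (\<open>Im_pick_pos\<close>). Since \<open>f_(n+1) = x + x^2 f_n + \<dots>\<close>, each
  step also raises the order of the first nonreal coefficient by exactly two
  (\<open>Im_pick_fps\<close>).

  Uniqueness of \<open>\<phi>\<close> uses that any associated series gives a root \<open>z = -\<phi>(x,y)\<close> of \<open>p\<close> for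
  small \<open>x, y\<close> (\<open>associated_series_root\<close>), where \<open>p\<close> has only one root because it is linear in
  \<open>z\<close>; the identity theorem for double power series (\<open>fps2_eqI\<close>) then determines the
  coefficients.
\<close>

section \<open>A chain of rational Pick functions\<close>

text \<open>
  The pair of numerator and denominator of \<open>f_n\<close>, where \<open>f_0 = i\<close> and
  \<open>f_(n+1) = x / (1 - x f_n)\<close>. Working with the pair keeps the recursion polynomial.
\<close>

primrec pick_fraction :: "nat \<Rightarrow> complex poly \<times> complex poly" where
  "pick_fraction 0 = ([:\<i>:], 1)"
| "pick_fraction (Suc n) =
     (pCons 0 (snd (pick_fraction n)), snd (pick_fraction n) - pCons 0 (fst (pick_fraction n)))"

definition pick_num :: "nat \<Rightarrow> complex poly" where
  "pick_num n = fst (pick_fraction n)"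

definition pick_den :: "nat \<Rightarrow> complex poly" where
  "pick_den n = snd (pick_fraction n)"

lemma pick_0: "pick_num 0 = [:\<i>:]" "pick_den 0 = 1"
  by (simp_all add: pick_num_def pick_den_def)

lemma pick_Suc:
  "pick_num (Suc n) = pCons 0 (pick_den n)"
  "pick_den (Suc n) = pick_den n - pCons 0 (pick_num n)"
  by (simp_all add: pick_num_def pick_den_def)

lemma coeff_0_pick_den: "coeff (pick_den n) 0 = 1"
  by (induction n) (simp_all add: pick_0 pick_Suc)

lemma poly_pick_den_0: "poly (pick_den n) 0 = 1"
  by (simp add: poly_0_coeff_0 coeff_0_pick_den)

lemma coeff_0_pick_num: "n > 0 \<Longrightarrow> coeff (pick_num n) 0 = 0"
  by (cases n) (simp_all add: pick_Suc)

lemma poly_pick_num_0: "n > 0 \<Longrightarrow> poly (pick_num n) 0 = 0"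
  by (simp add: poly_0_coeff_0 coeff_0_pick_num)

text \<open>
  The sign of \<open>Im (N/D)\<close> is that of \<open>Im (N * cnj D)\<close>, which also makes sense before \<open>D \<noteq> 0\<close> is
  known and in fact implies it. In this form one step of the recursion is the identity
  \<open>Im (x D * cnj (D - x N)) = Im x * |D|^2 + |x|^2 * Im (N * cnj D)\<close>.
\<close>

lemma Im_pick_pos:
  assumes "Im x \<ge> 0" "x \<noteq> 0"
  shows "Im (poly (pick_num n) x * cnj (poly (pick_den n) x)) > 0"
proof (induction n)
  case 0
  show ?case by (simp add: pick_0)
next
  case (Suc n)
  define N D where "N = poly (pick_num n) x" and "D = poly (pick_den n) x"
  have "x * D * cnj (D - x * N) = x * (D * cnj D) - (x * cnj x) * cnj (N * cnj D)"
    by (simp add: algebra_simps)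
  also have "\<dots> = x * of_real ((cmod D)\<^sup>2) - of_real ((cmod x)\<^sup>2) * cnj (N * cnj D)"
    by (simp only: complex_norm_square)
  finally have "x * D * cnj (D - x * N)
      = x * of_real ((cmod D)\<^sup>2) - of_real ((cmod x)\<^sup>2) * cnj (N * cnj D)" .
  moreover have "Im (w * of_real r) = r * Im w" "Im (of_real r * cnj w) = - (r * Im w)" for r w
    by simp_all
  ultimately have "Im (x * D * cnj (D - x * N))
      = Im x * (cmod D)\<^sup>2 + (cmod x)\<^sup>2 * Im (N * cnj D)"
    by (simp only: minus_complex.sel) simp
  moreover have "(cmod x)\<^sup>2 * Im (N * cnj D) > 0"
    using Suc assms by (simp add: N_def D_def)
  moreover have "Im x * (cmod D)\<^sup>2 \<ge> 0"
    using assms by simp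
  ultimately have "Im (x * D * cnj (D - x * N)) > 0"
    by linarith
  then show ?case
    by (simp add: pick_Suc N_def D_def)
qed

lemma Im_pick_nonneg:
  assumes "Im x \<ge> 0" "n > 0"
  shows "Im (poly (pick_num n) x * cnj (poly (pick_den n) x)) \<ge> 0"
  using Im_pick_pos[of x n] assms by (cases "x = 0") (auto simp: poly_pick_num_0 less_imp_le)

lemma poly_pick_den_nonzero:
  assumes "Im x \<ge> 0"
  shows "poly (pick_den n) x \<noteq> 0"
  using Im_pick_pos[of x n] assms by (cases "x = 0") (auto simp: poly_pick_den_0)

definition pick_fps :: "nat \<Rightarrow> complex fps" where
  "pick_fps n = fps_of_poly (pick_num n) * inverse (fps_of_poly (pick_den n))"

lemma pick_fps_mult_den: "pick_fps n * fps_of_poly (pick_den n) = fps_of_poly (pick_num n)"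
proof -
  have "inverse (fps_of_poly (pick_den n)) * fps_of_poly (pick_den n) = 1"
    by (rule inverse_mult_eq_1) (simp add: coeff_0_pick_den)
  then show ?thesis
    by (simp add: pick_fps_def mult.assoc)
qed

lemma pick_fps_0: "pick_fps 0 = fps_const \<i>"
  using pick_fps_mult_den[of 0] by (simp add: pick_0 fps_of_poly_const)

text \<open>
  The equation \<open>f_(n+1) (1 - x f_n) = x\<close>, arranged so that it computes the coefficients of
  \<open>f_(n+1)\<close> one after another: the factor \<open>x\<close> shifts the product on the right by one.
\<close>

lemma pick_fps_Suc: "pick_fps (Suc n) = fps_X + fps_X * (pick_fps n * pick_fps (Suc n))"
proof -
  let ?D = "fps_of_poly (pick_den n)"
  have "?D \<noteq> 0"
    using coeff_0_pick_den[of n] by auto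
  have "pick_fps (Suc n) * (?D - fps_X * fps_of_poly (pick_num n)) = fps_X * ?D"
    using pick_fps_mult_den[of "Suc n"]
    by (simp add: pick_Suc fps_of_poly_pCons fps_of_poly_diff mult.commute)
  then have "pick_fps (Suc n) * ?D = (fps_X + fps_X * (pick_fps n * pick_fps (Suc n))) * ?D"
    by (simp add: pick_fps_mult_den[symmetric] algebra_simps)
  then show ?thesis
    using \<open>?D \<noteq> 0\<close> by simp
qed

lemma fps_nth_0_pick_fps_Suc: "fps_nth (pick_fps (Suc n)) 0 = 0"
  by (subst pick_fps_Suc) simp

lemma fps_nth_Suc_pick_fps_Suc:
  "fps_nth (pick_fps (Suc n)) (Suc m) =
     (if m = 0 then 1 else 0) + (\<Sum>k\<le>m. fps_nth (pick_fps n) k * fps_nth (pick_fps (Suc n)) (m - k))"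
proof -
  have "fps_nth (pick_fps (Suc n)) (Suc m) =
      fps_nth (fps_X + fps_X * (pick_fps n * pick_fps (Suc n))) (Suc m)"
    by (simp only: pick_fps_Suc[symmetric])
  then show ?thesis
    by (simp add: fps_X_mult_nth fps_mult_nth[of "pick_fps n"] atMost_atLeast0)
qed

text \<open>
  In the recursion for the coefficient of order \<open>l + 1 \<le> 2n + 2\<close> of \<open>f_(n+1)\<close> every
  product is real or zero except for one: when \<open>l = 2n + 1\<close>, the first nonreal coefficient of \<open>f_n\<close>,
  at order \<open>2n\<close>, meets the linear coefficient \<open>1\<close> of \<open>f_(n+1)\<close>.
\<close>

lemma Im_pick_fps:
  "m \<le> 2 * n \<Longrightarrow> Im (fps_nth (pick_fps n) m) = (if m = 2 * n then 1 else 0)"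
proof (induction n arbitrary: m)
  case 0
  then show ?case by (simp add: pick_fps_0)
next
  case (Suc n)
  let ?F = "fps_nth (pick_fps n)" and ?G = "fps_nth (pick_fps (Suc n))"
  have G1: "?G 1 = 1"
    by (simp add: fps_nth_Suc_pick_fps_Suc[of n 0, simplified] fps_nth_0_pick_fps_Suc)
  show ?case
    using Suc.prems
  proof (induction m rule: less_induct)
    case (less m)
    show ?case
    proof (cases m)
      case 0
      then show ?thesis by (simp add: fps_nth_0_pick_fps_Suc)
    next
      case (Suc l)
      have l: "l \<le> 2 * n + 1"
        using less.prems Suc by simp
      have real_G: "Im (?G k) = 0" if "k \<le> l" for k
        using less.IH[of k] that l Suc by simp
      have summand: "Im (?F k * ?G (l - k)) = (if k = 2 * n \<and> l = 2 * n + 1 then 1 else 0)"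
        if k: "k \<le> l" for k
      proof -
        consider "k < 2 * n" | "k = 2 * n" "l = 2 * n" | "k = 2 * n" "l = 2 * n + 1" | "k = l" "k > 2 * n"
          using k l by linarith
        then show ?thesis
        proof cases
          case 1
          then show ?thesis using Suc.IH[of k] real_G[of "l - k"] by simp
        next
          case 3
          then show ?thesis using Suc.IH[of k] G1 by simp
        qed (simp_all add: fps_nth_0_pick_fps_Suc)
      qed
      have "Im (?G m) = (\<Sum>k\<le>l. Im (?F k * ?G (l - k)))"
        by (simp add: Suc fps_nth_Suc_pick_fps_Suc)
      also have "\<dots> = (\<Sum>k\<le>l. if k = 2 * n \<and> l = 2 * n + 1 then 1 else 0)"
        by (intro sum.cong refl summand) simp
      also have "\<dots> = (if m = 2 * Suc n then 1 else 0)"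
        using Suc by (cases "l = 2 * n + 1") (auto simp: sum.delta)
      finally show ?thesis .
    qed
  qed
qed

lemma fps_conv_radius_pick_fps: "fps_conv_radius (pick_fps n) > 0"
proof -
  have "fps_conv_radius (inverse (fps_of_poly (pick_den n))) > 0"
    by (rule fps_conv_radius_inverse_pos) (simp_all add: coeff_0_pick_den)
  then show ?thesis
    unfolding pick_fps_def
    by (intro less_le_trans[OF _ fps_conv_radius_mult]) simp
qed

lemma eval_pick_fps:
  assumes "ereal (norm x) < fps_conv_radius (pick_fps n)"
  shows "eval_fps (pick_fps n) x * poly (pick_den n) x = poly (pick_num n) x"
  using eval_fps_mult[of x "pick_fps n" "fps_of_poly (pick_den n)"] assms
  by (simp add: pick_fps_mult_den)

section \<open>Convergent power series in two variables\<close>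

lemma tendsto_fst_nhds: "(fst \<longlongrightarrow> x) (nhds (x, y))"
  using tendsto_fst[OF filterlim_ident, of "(x, y)"] by simp

lemma tendsto_snd_nhds: "(snd \<longlongrightarrow> y) (nhds (x, y))"
  using tendsto_snd[OF filterlim_ident, of "(x, y)"] by simp

lemma has_sum_eval_fps:
  fixes f :: "complex fps"
  assumes "ereal (norm x) < fps_conv_radius f"
  shows "((\<lambda>n. fps_nth f n * x ^ n) has_sum eval_fps f x) UNIV"
  by (rule norm_summable_imp_has_sum[OF norm_summable_fps[OF assms] sums_eval_fps[OF assms]])

text \<open>
  The identity theorem in one variable, for sums in the unconditional sense in which double
  series are summed. Convergence at a single nonzero point already makes the radius positive.
\<close>

lemma fps_eqI_infsum:
  fixes f g :: "complex fps"
  assumes "\<forall>\<^sub>F x in nhds 0. (\<lambda>n. fps_nth f n * x ^ n) summable_on UNIV"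
    and "\<forall>\<^sub>F x in nhds 0. (\<lambda>n. fps_nth g n * x ^ n) summable_on UNIV"
    and "\<forall>\<^sub>F x in nhds 0. (\<Sum>\<^sub>\<infinity>n. fps_nth f n * x ^ n) = (\<Sum>\<^sub>\<infinity>n. fps_nth g n * x ^ n)"
  shows "f = g"
proof -
  have radius: "fps_conv_radius h > 0" 
    if "\<forall>\<^sub>F x in nhds 0. (\<lambda>n. fps_nth h n * x ^ n) summable_on UNIV" for h :: "complex fps"
  proof -
    have "\<forall>\<^sub>F x in at 0. (\<lambda>n. fps_nth h n * x ^ n) summable_on UNIV \<and> x \<noteq> 0"
      using that by (auto simp: eventually_at_filter elim: eventually_mono)
    then obtain x where "(\<lambda>n. fps_nth h n * x ^ n) summable_on UNIV" "x \<noteq> 0"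
      using eventually_happens[of _ "at (0::complex)"] by auto
    then have "ereal (norm x) \<le> fps_conv_radius h" "0 < ereal (norm x)"
      unfolding fps_conv_radius_def
      by (auto intro!: conv_radius_geI summable_on_imp_summable)
    then show ?thesis
      by (rule less_le_trans[rotated])
  qed
  have eval: "eval_fps h x = (\<Sum>\<^sub>\<infinity>n. fps_nth h n * x ^ n)"
    if "(\<lambda>n. fps_nth h n * x ^ n) summable_on UNIV" for h :: "complex fps" and x
    using has_sum_imp_sums[OF has_sum_infsum[OF that]] by (simp add: eval_fps_def sums_iff)
  have "\<forall>\<^sub>F x in nhds 0. eval_fps f x = eval_fps g x"
    using assms by eventually_elim (simp add: eval)
  then show ?thesis
    by (intro eval_fps_eqD radius assms(1,2))
qed

text \<open>
  The identity theorem for double series is that for single series, used twice: first in \<open>x\<close>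
  with \<open>y\<close> fixed, for the coefficients \<open>\<Sum>j. a_ij y^j\<close>, and then in \<open>y\<close>.
\<close>

lemma fps2_eqI:
  assumes "f \<in> conv_fps2" "g \<in> conv_fps2"
    and "\<forall>\<^sub>F (x, y) in nhds (0, 0). eval_fps2 f x y = eval_fps2 g x y"
  shows "f = g"
proof -
  have "\<forall>\<^sub>F w in nhds 0 \<times>\<^sub>F nhds 0. case w of (x, y) \<Rightarrow> fps2_term f x y summable_on UNIV \<and>
      fps2_term g x y summable_on UNIV \<and> eval_fps2 f x y = eval_fps2 g x y"
    using assms unfolding conv_fps2_def nhds_prod[symmetric] 
    by (auto intro: eventually_conj simp: case_prod_unfold)
  then obtain P Q where PQ: "eventually P (nhds 0)" "eventually Q (nhds 0)"
    and sum_f: "\<And>x y. P x \<Longrightarrow> Q y \<Longrightarrow> fps2_term f x y summable_on UNIV"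
    and sum_g: "\<And>x y. P x \<Longrightarrow> Q y \<Longrightarrow> fps2_term g x y summable_on UNIV"
    and eq: "\<And>x y. P x \<Longrightarrow> Q y \<Longrightarrow> eval_fps2 f x y = eval_fps2 g x y"
    unfolding eventually_prod_filter by auto
  have "\<forall>\<^sub>F x in at 0. P x \<and> x \<noteq> 0"
    using PQ(1) by (auto simp: eventually_at_filter elim: eventually_mono)
  \<comment> \<open>Summability at a point with nonzero first coordinate passes to each row of coefficients.\<close>
  then obtain x0 where x0: "P x0" "x0 \<noteq> 0"
    using eventually_happens[of _ "at (0::complex)"] by auto
  have row: "(\<lambda>j. fps2_nth h i j * y ^ j) summable_on UNIV"
    if "fps2_term h x0 y summable_on UNIV" for h i y
  proof -
    have "(\<lambda>(i, j). fps2_nth h i j * x0 ^ i * y ^ j) summable_on UNIV \<times> UNIV"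
      using that by (simp add: fps2_term_def)
    then have "(\<lambda>j. fps2_nth h i j * x0 ^ i * y ^ j) summable_on UNIV"
      by (rule summable_on_SigmaD1) auto
    then have "(\<lambda>j. inverse (x0 ^ i) * (fps2_nth h i j * x0 ^ i * y ^ j)) summable_on UNIV"
      by (rule summable_on_cmult_right)
    then show ?thesis
      using x0 by (simp add: field_simps)
  qed
  define s where "s = (\<lambda>(h :: complex fps fps) i y. \<Sum>\<^sub>\<infinity>j. fps2_nth h i j * y ^ j)"
  have inner: "(\<Sum>\<^sub>\<infinity>j. fps2_term h x y (i, j)) = s h i y * x ^ i" for h x y i
  proof -
    have "(\<Sum>\<^sub>\<infinity>j. fps2_term h x y (i, j)) = (\<Sum>\<^sub>\<infinity>j. x ^ i * (fps2_nth h i j * y ^ j))"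
      by (simp add: fps2_term_def algebra_simps)
    also have "\<dots> = x ^ i * s h i y"
      unfolding s_def by (rule infsum_cmult_right')
    finally show ?thesis by (simp add: mult.commute)
  qed
  have outer_summable: "(\<lambda>i. s h i y * x ^ i) summable_on UNIV"
    if "fps2_term h x y summable_on UNIV" for h x y
    using summable_on_Sigma_banach[of "\<lambda>i j. fps2_term h x y (i, j)" UNIV "\<lambda>_. UNIV"] that
    by (simp add: inner)
  have outer: "eval_fps2 h x y = (\<Sum>\<^sub>\<infinity>i. s h i y * x ^ i)"
    if "fps2_term h x y summable_on UNIV" for h x y
    using infsum_Sigma_banach[of "fps2_term h x y" UNIV "\<lambda>_. UNIV"] that
    by (simp add: inner eval_fps2_def)
  have s_eq: "s f i y = s g i y" if "Q y" for i y
  proof -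
    have "Abs_fps (\<lambda>i. s f i y) = Abs_fps (\<lambda>i. s g i y)"
    proof (rule fps_eqI_infsum)
      show "\<forall>\<^sub>F x in nhds 0. (\<Sum>\<^sub>\<infinity>n. fps_nth (Abs_fps (\<lambda>i. s f i y)) n * x ^ n) =
          (\<Sum>\<^sub>\<infinity>n. fps_nth (Abs_fps (\<lambda>i. s g i y)) n * x ^ n)"
        using PQ(1) by eventually_elim (use that in \<open>simp add: outer[symmetric] sum_f sum_g eq\<close>)
    qed (use PQ(1) that in \<open>auto elim!: eventually_mono intro!: outer_summable sum_f sum_g\<close>)
    then show ?thesis
      by (simp add: fps_eq_iff)
  qed
  have "fps2_nth f i j = fps2_nth g i j" for i j
  proof -
    have "Abs_fps (\<lambda>j. fps2_nth f i j) = Abs_fps (\<lambda>j. fps2_nth g i j)"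
    proof (rule fps_eqI_infsum)
      show "\<forall>\<^sub>F y in nhds 0. (\<Sum>\<^sub>\<infinity>n. fps_nth (Abs_fps (\<lambda>j. fps2_nth f i j)) n * y ^ n) =
          (\<Sum>\<^sub>\<infinity>n. fps_nth (Abs_fps (\<lambda>j. fps2_nth g i j)) n * y ^ n)"
        using PQ(2) by eventually_elim (use s_eq in \<open>simp add: s_def\<close>)
    qed (use PQ(2) x0 in \<open>auto elim!: eventually_mono intro!: row sum_f sum_g\<close>)
    then show ?thesis
      by (simp add: fps_eq_iff)
  qed
  then show ?thesis
    by (simp add: fps_eq_iff fps2_nth_def)
qed

text \<open>
  Continuity at the origin. If the terms at \<open>(w, w)\<close> are absolutely summable, then shrinking both
  variables to absolute value at most \<open>t * |w|\<close>, with \<open>t \<le> 1\<close>, shrinks each nonconstant term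
  by at least the factor \<open>t\<close>.
\<close>

lemma tendsto_eval_fps2_0:
  assumes "f \<in> conv_fps2" "fps2_nth f 0 0 = 0"
  shows "((\<lambda>(x, y). eval_fps2 f x y) \<longlongrightarrow> 0) (nhds (0, 0))"
proof -
  have "\<forall>\<^sub>F w in nhds 0 \<times>\<^sub>F nhds 0. case w of (x, y) \<Rightarrow> fps2_term f x y summable_on UNIV"
    using assms(1) by (simp add: conv_fps2_def nhds_prod)
  then have "\<forall>\<^sub>F x in nhds 0. fps2_term f x x summable_on UNIV"
    by (simp add: eventually_prod_same) (auto elim!: eventually_mono)
  then have "\<forall>\<^sub>F x in at 0. fps2_term f x x summable_on UNIV \<and> x \<noteq> 0"
    by (auto simp: eventually_at_filter elim: eventually_mono)
  then obtain w where w: "fps2_term f w w summable_on UNIV" "w \<noteq> 0"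
    using eventually_happens[of _ "at (0::complex)"] by auto
  define r where "r = norm w"
  have "r > 0" using w by (simp add: r_def)
  define M where "M = (\<Sum>\<^sub>\<infinity>n. norm (fps2_term f w w n))"
  have abs_w: "(\<lambda>n. norm (fps2_term f w w n)) summable_on UNIV"
    using w(1) summable_on_iff_abs_summable_on_complex by blast
  have bound: "norm (eval_fps2 f x y) \<le> (norm x + norm y) / r * M"
    if small: "norm x + norm y < r" for x y
  proof -
    define t where "t = (norm x + norm y) / r"
    have t: "0 \<le> t" "t \<le> 1" and nx: "norm x \<le> t * r" and ny: "norm y \<le> t * r"
      using small \<open>r > 0\<close> by (auto simp: t_def field_simps)
    have le: "norm (fps2_term f x y n) \<le> t * norm (fps2_term f w w n)" for n
    proof (cases "n = (0, 0)")
      case True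
      then show ?thesis
        using assms(2) by (simp add: fps2_term_def)
    next
      case False
      obtain i j where n: "n = (i, j)" by fastforce
      have "norm x ^ i * norm y ^ j \<le> (t * r) ^ i * (t * r) ^ j"
        using nx ny t \<open>r > 0\<close> by (intro mult_mono power_mono) auto
      also have "\<dots> = t ^ (i + j) * (r ^ i * r ^ j)"
        by (simp add: power_mult_distrib power_add)
      also have "\<dots> \<le> t ^ 1 * (r ^ i * r ^ j)"
        using False n t \<open>r > 0\<close> by (intro mult_right_mono power_decreasing) auto
      finally have "norm (fps2_nth f i j) * (norm x ^ i * norm y ^ j)
          \<le> norm (fps2_nth f i j) * (t * (r ^ i * r ^ j))"
        by (intro mult_left_mono) simp_all
      then show ?thesis
        by (simp add: n fps2_term_def norm_mult norm_power r_def algebra_simps)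
    qed
    have sum_t: "(\<lambda>n. t * norm (fps2_term f w w n)) summable_on UNIV"
      by (intro summable_on_cmult_right abs_w)
    have abs: "(\<lambda>n. norm (fps2_term f x y n)) summable_on UNIV"
      by (rule summable_on_comparison_test[OF sum_t]) (use le in auto)
    have "norm (eval_fps2 f x y) \<le> (\<Sum>\<^sub>\<infinity>n. norm (fps2_term f x y n))"
      unfolding eval_fps2_def by (rule norm_infsum_bound[OF abs])
    also have "\<dots> \<le> (\<Sum>\<^sub>\<infinity>n. t * norm (fps2_term f w w n))"
      by (rule infsum_mono[OF abs sum_t le])
    also have "\<dots> = t * M"
      unfolding M_def by (rule infsum_cmult_right')
    finally show ?thesis by (simp add: t_def)
  qed
  have lim: "((\<lambda>w :: complex \<times> complex. norm (fst w) + norm (snd w)) \<longlongrightarrow> 0) (nhds (0, 0))"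
    by (rule tendsto_eq_intros refl filterlim_ident | simp)+
  show ?thesis
  proof (rule Lim_null_comparison)
    show "\<forall>\<^sub>F w in nhds (0, 0). norm (case w of (x, y) \<Rightarrow> eval_fps2 f x y)
        \<le> (norm (fst w) + norm (snd w)) / r * M"
      using order_tendstoD(2)[OF lim \<open>r > 0\<close>] by eventually_elim (subst case_prod_unfold, rule bound)
    show "((\<lambda>w :: complex \<times> complex. (norm (fst w) + norm (snd w)) / r * M) \<longlongrightarrow> 0) (nhds (0, 0))"
      using tendsto_mult_right[OF tendsto_divide[OF lim tendsto_const[of r]], of M] \<open>r > 0\<close> by simp
  qed
qed

text \<open>
  Substituting \<open>z = -\<phi>(x,y)\<close> kills the factor \<open>z + \<phi>\<close>. The substitution stays inside the
  neighbourhood where the factorization holds because \<open>\<phi>\<close> is continuous with value 0 at the origin.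
\<close>

lemma associated_series_root:
  assumes "associated_series p \<phi>"
  shows "\<forall>\<^sub>F (x, y) in nhds (0, 0). poly3 p x y (- eval_fps2 \<phi> x y) = 0"
proof -
  from assms obtain u where conv: "\<phi> \<in> conv_fps2" "fps2_nth \<phi> 0 0 = 0"
    and ev: "\<forall>\<^sub>F (x, y, z) in nhds (0, 0, 0).
      poly3 p x y z = eval_fps3 u x y z * (z + eval_fps2 \<phi> x y)"
    unfolding associated_series_def by blast
  have "((\<lambda>w. - (case w of (x, y) \<Rightarrow> eval_fps2 \<phi> x y)) \<longlongrightarrow> 0) (nhds (0, 0))"
    using tendsto_minus[OF tendsto_eval_fps2_0[OF conv]] by simp
  then have "((\<lambda>w. (fst w, snd w, - eval_fps2 \<phi> (fst w) (snd w))) \<longlongrightarrow> (0, 0, 0)) (nhds (0, 0))"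
    using tendsto_fst_nhds[of "0::complex" "0::complex"] tendsto_snd_nhds[of "0::complex" "0::complex"]
    by (intro tendsto_Pair) (simp_all only: case_prod_unfold)
  then have "filterlim (\<lambda>w. (fst w, snd w, - eval_fps2 \<phi> (fst w) (snd w)))
      (nhds (0, 0, 0)) (nhds (0, 0))" .
  from eventually_compose_filterlim[OF ev this] show ?thesis
    by (simp add: case_prod_unfold)
qed

section \<open>Series and polynomials with separated variables\<close>

text \<open>
  The series \<open>f(x) + f(y)\<close>. The first summand is \<open>f\<close> in the inner variable \<open>x\<close>; the second has
  constant coefficients with respect to \<open>x\<close>.
\<close>

definition separated_sum :: "'a::comm_ring_1 fps \<Rightarrow> 'a fps fps" where
  "separated_sum f = fps_const f + Abs_fps (\<lambda>j. fps_const (fps_nth f j))"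

lemma fps2_nth_separated_sum:
  "fps2_nth (separated_sum f) i j =
     (if j = 0 then fps_nth f i else 0) + (if i = 0 then fps_nth f j else 0)"
  by (simp add: fps2_nth_def separated_sum_def)

lemma has_sum_separated_sum:
  assumes "ereal (norm x) < fps_conv_radius f" "ereal (norm y) < fps_conv_radius f"
  shows "(fps2_term (separated_sum f) x y has_sum (eval_fps f x + eval_fps f y)) UNIV"
proof -
  have "((\<lambda>(i, j). if j = 0 then fps_nth f i * x ^ i else 0) has_sum eval_fps f x) (range (\<lambda>i. (i, 0::nat)))"
    using has_sum_eval_fps[OF assms(1)] by (subst has_sum_reindex) (auto simp: inj_on_def o_def)
  then have 1: "((\<lambda>(i, j::nat). if j = 0 then fps_nth f i * x ^ i else 0) has_sum eval_fps f x) UNIV"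
    by (rule has_sum_cong_neutral[THEN iffD1, rotated -1]) auto
  have "((\<lambda>(i, j). if i = 0 then fps_nth f j * y ^ j else 0) has_sum eval_fps f y) (range (\<lambda>j. (0::nat, j)))"
    using has_sum_eval_fps[OF assms(2)] by (subst has_sum_reindex) (auto simp: inj_on_def o_def)
  then have 2: "((\<lambda>(i::nat, j). if i = 0 then fps_nth f j * y ^ j else 0) has_sum eval_fps f y) UNIV"
    by (rule has_sum_cong_neutral[THEN iffD1, rotated -1]) auto
  show ?thesis
    by (rule has_sum_cong[THEN iffD1, OF _ has_sum_add[OF 1 2]])
      (auto simp: fps2_term_def fps2_nth_separated_sum algebra_simps)
qed

lemma eventually_norm_less_conv_radius:
  assumes "fps_conv_radius f > 0"
  shows "\<forall>\<^sub>F (x::complex) in nhds 0. ereal (norm x) < fps_conv_radius f"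
proof -
  obtain r where r: "0 < ereal r" "ereal r < fps_conv_radius f"
    using ereal_dense2[OF assms] by auto
  have "\<forall>\<^sub>F (x::complex) in nhds 0. norm x < r"
    by (rule order_tendstoD) (use r in \<open>auto intro!: tendsto_eq_intros filterlim_ident\<close>)
  then show ?thesis
    by eventually_elim (use r in \<open>auto intro: less_trans[of _ "ereal r"]\<close>)
qed

lemma eventually_norms_less_conv_radius:
  assumes "fps_conv_radius f > 0"
  shows "\<forall>\<^sub>F (x :: complex, y :: complex) in nhds (0, 0).
    ereal (norm x) < fps_conv_radius f \<and> ereal (norm y) < fps_conv_radius f"
  using eventually_compose_filterlim[OF eventually_norm_less_conv_radius[OF assms] tendsto_fst_nhds]
    eventually_compose_filterlim[OF eventually_norm_less_conv_radius[OF assms] tendsto_snd_nhds]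
  by eventually_elim auto

lemma eventually_has_sum_separated_sum:
  assumes "fps_conv_radius f > 0"
  shows "\<forall>\<^sub>F (x, y) in nhds (0, 0).
    (fps2_term (separated_sum f) x y has_sum (eval_fps f x + eval_fps f y)) UNIV"
  using eventually_norms_less_conv_radius[OF assms]
  by eventually_elim (auto intro: has_sum_separated_sum)

lemma separated_sum_conv:
  assumes "fps_conv_radius f > 0"
  shows "separated_sum f \<in> conv_fps2"
  using eventually_has_sum_separated_sum[OF assms]
  by (auto simp: conv_fps2_def summable_on_def elim: eventually_mono)

lemma eventually_eval_separated_sum:
  assumes "fps_conv_radius f > 0"
  shows "\<forall>\<^sub>F (x, y) in nhds (0, 0). eval_fps2 (separated_sum f) x y = eval_fps f x + eval_fps f y"
  using eventually_has_sum_separated_sum[OF assms]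
  by (auto simp: eval_fps2_def infsumI elim: eventually_mono)

text \<open>
  The series \<open>d(x) d(y)\<close> in three variables, constant in \<open>z\<close>.
\<close>

definition separated_product :: "'a::comm_ring_1 poly \<Rightarrow> 'a fps fps fps" where
  "separated_product d = fps_const (Abs_fps (\<lambda>j. fps_const (coeff d j) * fps_of_poly d))"

lemma fps3_nth_separated_product:
  "fps3_nth (separated_product d) i j k = (if k = 0 then coeff d i * coeff d j else 0)"
  by (simp add: fps3_nth_def separated_product_def mult.commute)

lemma has_sum_separated_product:
  "(fps3_term (separated_product d) x y z has_sum (poly d x * poly d y)) UNIV"
proof -
  let ?S = "{..degree d} \<times> {..degree d} \<times> {0::nat}"
  have "(fps3_term (separated_product d) x y z has_sum sum (fps3_term (separated_product d) x y z) ?S) ?S"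
    by (rule has_sum_finite) simp
  moreover have "sum (fps3_term (separated_product d) x y z) ?S = poly d x * poly d y"
    unfolding poly_altdef sum_product sum.cartesian_product'
    by (simp add: fps3_term_def fps3_nth_separated_product algebra_simps)
  ultimately have "(fps3_term (separated_product d) x y z has_sum (poly d x * poly d y)) ?S"
    by simp
  then show ?thesis
    by (rule has_sum_cong_neutral[THEN iffD1, rotated -1])
      (auto simp: fps3_term_def fps3_nth_separated_product not_le dest: le_degree split: if_splits)
qed

lemma separated_product_conv: "separated_product d \<in> conv_fps3"
proof -
  have "fps3_term (separated_product d) x y z summable_on UNIV" for x y z
    using has_sum_separated_product by (rule has_sum_imp_summable)
  then show ?thesis
    unfolding conv_fps3_def by (simp add: case_prod_unfold)
qed

lemma eval_separated_product: "eval_fps3 (separated_product d) x y z = poly d x * poly d y"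
  unfolding eval_fps3_def by (rule infsumI has_sum_separated_product)+

definition poly_in_y :: "'a::comm_ring_1 poly \<Rightarrow> 'a poly poly" where
  "poly_in_y d = map_poly (\<lambda>c. [:c:]) d"

lemma poly_poly_in_y: "poly (poly_in_y d) [:y:] = [:poly d y:]"
  by (induction d) (simp_all add: poly_in_y_def map_poly_pCons)

text \<open>
  The polynomial \<open>d(x) d(y) z + n(x) d(y) + n(y) d(x)\<close>, that is
  \<open>d(x) d(y) (z + f(x) + f(y))\<close> for \<open>f = n/d\<close>.
\<close>

definition separated_poly :: "'a::comm_ring_1 poly \<Rightarrow> 'a poly \<Rightarrow> 'a poly poly poly" where
  "separated_poly n d =
     [:[:n:] * poly_in_y d + [:d:] * poly_in_y n, [:d:] * poly_in_y d:]"

lemma poly3_separated_poly: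
  "poly3 (separated_poly n d) x y z =
     poly d x * poly d y * z + poly n x * poly d y + poly n y * poly d x"
  by (simp add: poly3_def separated_poly_def poly_poly_in_y mult.commute)

lemma poly3_pderiv_separated_poly:
  "poly3 (pderiv (separated_poly n d)) x y z = poly d x * poly d y"
  by (simp add: poly3_def separated_poly_def poly_poly_in_y pderiv_pCons mult.commute)

lemma homogeneous_part_Im_separated_sum:
  assumes "n > 0"
  shows "homogeneous_part (Im_fps2 (separated_sum f)) n =
     monom (monom (Im (fps_nth f n)) n) 0 + monom (monom (Im (fps_nth f n)) 0) n"
proof -
  let ?t = "\<lambda>i. monom (monom (fps2_nth (Im_fps2 (separated_sum f)) i (n - i)) i) (n - i)"
  have nth: "fps2_nth (Im_fps2 (separated_sum f)) i j =
      (if j = 0 then Im (fps_nth f i) else 0) + (if i = 0 then Im (fps_nth f j) else 0)" for i j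
    using fps2_nth_separated_sum[of f i j] by (simp add: Im_fps2_def fps2_nth_def)
  have "homogeneous_part (Im_fps2 (separated_sum f)) n = sum ?t {..n}"
    by (simp add: homogeneous_part_def)
  also have "\<dots> = sum ?t {0, n}"
    by (rule sum.mono_neutral_right) (auto simp: nth)
  also have "\<dots> = monom (monom (Im (fps_nth f n)) n) 0 + monom (monom (Im (fps_nth f n)) 0) n"
    using assms by (simp add: nth)
  finally show ?thesis .
qed

section \<open>The polynomial\<close>

lemma closure_upper_half_space3_Im_nonneg:
  assumes "(x, y, z) \<in> closure upper_half_space3"
  shows "Im x \<ge> 0" "Im y \<ge> 0" "Im z \<ge> 0"
proof -
  have "closure upper_half_plane \<subseteq> {z. Im z \<ge> 0}"
    by (rule closure_minimal) (auto simp: upper_half_plane_def closed_halfspace_Im_ge)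
  then show "Im x \<ge> 0" "Im y \<ge> 0" "Im z \<ge> 0"
    using assms by (auto simp: upper_half_space3_def closure_Times)
qed

lemma zero_in_closure_upper_half_space3: "(0, 0, 0) \<in> closure upper_half_space3"
proof -
  have "(0::complex) \<in> closure upper_half_plane"
    unfolding closure_approachable
  proof (intro allI impI)
    fix e :: real assume "e > 0"
    then show "\<exists>y\<in>upper_half_plane. dist y 0 < e"
      by (intro bexI[of _ "Complex 0 (e / 2)"]) (auto simp: upper_half_plane_def cmod_def)
  qed
  then show ?thesis
    by (simp add: upper_half_space3_def closure_Times)
qed

text \<open>
  At a zero, multiplying by the conjugate of \<open>D(x) D(y)\<close> turns the imaginary part into
  a sum of three nonnegative terms, positive multiples of \<open>Im z\<close>, \<open>Im f(x)\<close> and \<open>Im f(y)\<close>. So all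
  three vanish, and \<open>Im f\<close> vanishes on the closed half plane only at \<open>0\<close>.
\<close>

lemma zeros_separated_pick_poly:
  assumes "n > 0" "Im x \<ge> 0" "Im y \<ge> 0" "Im z \<ge> 0"
  shows "poly3 (separated_poly (pick_num n) (pick_den n)) x y z = 0 \<longleftrightarrow> x = 0 \<and> y = 0 \<and> z = 0"
proof
  assume zero: "poly3 (separated_poly (pick_num n) (pick_den n)) x y z = 0"
  define a b c d where "a = poly (pick_num n) x" and "b = poly (pick_den n) x"
    and "c = poly (pick_num n) y" and "d = poly (pick_den n) y"
  have "b \<noteq> 0" "d \<noteq> 0"
    using assms by (simp_all add: b_def d_def poly_pick_den_nonzero)
  have "0 = (b * d * z + a * d + c * b) * cnj (b * d)"
    using zero by (simp add: poly3_separated_poly a_def b_def c_def d_def)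
  also have "\<dots> = (b * cnj b) * (d * cnj d) * z + (d * cnj d) * (a * cnj b) + (b * cnj b) * (c * cnj d)"
    by (simp add: algebra_simps)
  also have "\<dots> = of_real ((cmod b)\<^sup>2 * (cmod d)\<^sup>2) * z + of_real ((cmod d)\<^sup>2) * (a * cnj b)
      + of_real ((cmod b)\<^sup>2) * (c * cnj d)"
    by (simp only: complex_norm_square of_real_mult)
  finally have "Im (of_real ((cmod b)\<^sup>2 * (cmod d)\<^sup>2) * z + of_real ((cmod d)\<^sup>2) * (a * cnj b)
      + of_real ((cmod b)\<^sup>2) * (c * cnj d)) = 0"
    by (metis zero_complex.simps(2))
  moreover have Im_scale: "Im (complex_of_real r * w) = r * Im w" for r w
    by simp
  ultimately have sum: "(cmod b)\<^sup>2 * (cmod d)\<^sup>2 * Im z + (cmod d)\<^sup>2 * Im (a * cnj b)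
      + (cmod b)\<^sup>2 * Im (c * cnj d) = 0"
    by (simp only: plus_complex.sel Im_scale)
  have nonneg: "(cmod b)\<^sup>2 * (cmod d)\<^sup>2 * Im z \<ge> 0" "(cmod d)\<^sup>2 * Im (a * cnj b) \<ge> 0"
      "(cmod b)\<^sup>2 * Im (c * cnj d) \<ge> 0"
    using assms Im_pick_nonneg[of x n] Im_pick_nonneg[of y n]
    by (auto simp only: a_def b_def c_def d_def intro!: mult_nonneg_nonneg zero_le_power2)
  have "(cmod d)\<^sup>2 * Im (a * cnj b) = 0" "(cmod b)\<^sup>2 * Im (c * cnj d) = 0"
    using sum nonneg by linarith+
  then have "Im (a * cnj b) = 0" "Im (c * cnj d) = 0"
    using \<open>b \<noteq> 0\<close> \<open>d \<noteq> 0\<close> by (simp_all only: mult_eq_0_iff) simp_all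
  then have "x = 0" "y = 0"
    using Im_pick_pos[of x n] Im_pick_pos[of y n] assms by (force simp: a_def b_def c_def d_def)+
  then have "z = 0"
    using zero assms(1) by (simp add: poly3_separated_poly poly_pick_num_0 poly_pick_den_0)
  with \<open>x = 0\<close> \<open>y = 0\<close> show "x = 0 \<and> y = 0 \<and> z = 0" by simp
qed (use assms(1) in \<open>simp add: poly3_separated_poly poly_pick_num_0\<close>)

text \<open>
  The polynomial equals \<open>D(x) D(y) (z + f(x) + f(y))\<close>, so \<open>f(x) + f(y)\<close> is associated to it with
  the polynomial unit \<open>D(x) D(y)\<close>. Conversely \<open>D(x) D(y)\<close> does not vanish near the origin, so
  \<open>z = -f(x) - f(y)\<close> is the only root there, and the root given by any associated series must agree
  with it.
\<close>

lemma associated_series_separated_pick_poly: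
  assumes "n > 0"
  shows "associated_series (separated_poly (pick_num n) (pick_den n)) \<phi> \<longleftrightarrow>
    \<phi> = separated_sum (pick_fps n)"
proof -
  let ?p = "separated_poly (pick_num n) (pick_den n)"
  let ?\<phi> = "separated_sum (pick_fps n)"
  note radius = fps_conv_radius_pick_fps[of n]
  have "fps_nth (pick_fps n) 0 = 0"
    using assms fps_nth_0_pick_fps_Suc by (cases n) auto
  have factor: "\<forall>\<^sub>F (x, y) in nhds (0, 0). \<forall>z.
      poly3 ?p x y z = poly (pick_den n) x * poly (pick_den n) y * (z + eval_fps2 ?\<phi> x y)"
  proof -
    have "poly3 ?p x y z = poly (pick_den n) x * poly (pick_den n) y * (z + eval_fps2 ?\<phi> x y)"
      if "ereal (norm x) < fps_conv_radius (pick_fps n)" "ereal (norm y) < fps_conv_radius (pick_fps n)"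
        "eval_fps2 ?\<phi> x y = eval_fps (pick_fps n) x + eval_fps (pick_fps n) y" for x y z
      unfolding poly3_separated_poly that(3) eval_pick_fps[OF that(1), symmetric]
        eval_pick_fps[OF that(2), symmetric]
      by (simp add: algebra_simps)
    with eventually_eval_separated_sum[OF radius] eventually_norms_less_conv_radius[OF radius]
    show ?thesis
      by (auto elim: eventually_elim2)
  qed
  show ?thesis
  proof
    assume assoc: "associated_series ?p \<phi>"
    have den: "\<forall>\<^sub>F w in nhds (0, 0). poly (pick_den n) (fst w) * poly (pick_den n) (snd w) \<noteq> 0"
    proof (rule tendsto_imp_eventually_ne)
      show "((\<lambda>w. poly (pick_den n) (fst w) * poly (pick_den n) (snd w)) \<longlongrightarrow> 1) (nhds (0, 0))"
        using tendsto_mult[OF isCont_tendsto_compose[OF poly_isCont tendsto_fst_nhds]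
            isCont_tendsto_compose[OF poly_isCont tendsto_snd_nhds],
            of "pick_den n" "pick_den n" "0::complex" "0::complex"]
        by (simp add: poly_pick_den_0)
    qed simp
    have "\<forall>\<^sub>F (x, y) in nhds (0, 0). eval_fps2 \<phi> x y = eval_fps2 ?\<phi> x y"
      using associated_series_root[OF assoc] factor den by eventually_elim auto
    then show "\<phi> = ?\<phi>"
      using assoc separated_sum_conv[OF radius] by (intro fps2_eqI) (simp_all add: associated_series_def)
  next
    assume \<phi>: "\<phi> = ?\<phi>"
    have "filterlim (\<lambda>w :: complex \<times> complex \<times> complex. (fst w, fst (snd w))) (nhds (0, 0)) (nhds (0, 0, 0))"
      using tendsto_fst[OF tendsto_snd_nhds[of "(0, 0) :: complex \<times> complex" "0 :: complex"]]
      by (intro tendsto_Pair tendsto_fst_nhds) simp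
    from eventually_compose_filterlim[OF factor this]
    have "\<forall>\<^sub>F (x, y, z) in nhds (0, 0, 0). poly3 ?p x y z =
        eval_fps3 (separated_product (pick_den n)) x y z * (z + eval_fps2 ?\<phi> x y)"
      by (auto simp: eval_separated_product elim!: eventually_mono)
    then show "associated_series ?p \<phi>"
      unfolding associated_series_def \<phi>
      using separated_sum_conv[OF radius] separated_product_conv \<open>fps_nth (pick_fps n) 0 = 0\<close>
      by (auto simp: fps2_nth_separated_sum fps3_nth_separated_product coeff_0_pick_den
          intro!: bexI[of _ "separated_product (pick_den n)"])
  qed
qed

theorem proposition1p6:
  fixes L :: nat
  assumes "L \<ge> 1"
  shows "\<exists>p :: complex poly poly poly.
    (\<forall>(x, y, z)\<in>upper_half_space3. poly3 p x y z \<noteq> 0) \<and>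
    {(x, y, z) \<in> closure upper_half_space3. poly3 p x y z = 0} = {(0, 0, 0)} \<and>
    poly3 (pderiv p) 0 0 0 \<noteq> 0 \<and>
    (\<exists>!\<phi>. associated_series p \<phi>) \<and>
    (\<forall>\<phi>. associated_series p \<phi> \<longrightarrow>
       vanishes_to_order (Im_fps2 \<phi>) (2 * L) \<and>
       positive_definite (homogeneous_part (Im_fps2 \<phi>) (2 * L)))"
proof -
  have L: "L > 0" using assms by simp
  define p where "p = separated_poly (pick_num L) (pick_den L)"
  define \<phi> where "\<phi> = separated_sum (pick_fps L)"
  have series: "associated_series p \<psi> \<longleftrightarrow> \<psi> = \<phi>" for \<psi>
    unfolding p_def \<phi>_def by (rule associated_series_separated_pick_poly[OF L])
  have zeros: "poly3 p x y z = 0 \<longleftrightarrow> x = 0 \<and> y = 0 \<and> z = 0"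
    if "Im x \<ge> 0" "Im y \<ge> 0" "Im z \<ge> 0" for x y z
    unfolding p_def by (rule zeros_separated_pick_poly[OF L that])
  have "poly3 p x y z \<noteq> 0" if "(x, y, z) \<in> upper_half_space3" for x y z
    using that zeros[of x y z] by (auto simp: upper_half_space3_def upper_half_plane_def)
  moreover have "{(x, y, z) \<in> closure upper_half_space3. poly3 p x y z = 0} = {(0, 0, 0)}"
  proof (intro equalityI subsetI)
    fix w assume "w \<in> {(x, y, z) \<in> closure upper_half_space3. poly3 p x y z = 0}"
    then obtain x y z where w: "w = (x, y, z)" "(x, y, z) \<in> closure upper_half_space3"
      and "poly3 p x y z = 0" by blast
    then show "w \<in> {(0, 0, 0)}"
      using zeros[OF closure_upper_half_space3_Im_nonneg[OF w(2)]] by simp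
  next
    fix w :: "complex \<times> complex \<times> complex" assume "w \<in> {(0, 0, 0)}"
    then show "w \<in> {(x, y, z) \<in> closure upper_half_space3. poly3 p x y z = 0}"
      using zeros[of 0 0 0] zero_in_closure_upper_half_space3 by simp
  qed
  moreover have deriv: "poly3 (pderiv p) 0 0 0 \<noteq> 0"
    by (simp add: p_def poly3_pderiv_separated_poly poly_pick_den_0)
  have top: "homogeneous_part (Im_fps2 \<phi>) (2 * L) =
      monom (monom 1 (2 * L)) 0 + monom (monom 1 0) (2 * L)"
    using L by (simp add: \<phi>_def homogeneous_part_Im_separated_sum Im_pick_fps)
  have eval: "poly2 (homogeneous_part (Im_fps2 \<phi>) (2 * L)) x y = x ^ (2 * L) + y ^ (2 * L)" for x y
    unfolding top by (simp add: poly2_def poly_monom)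
  then have posdef: "positive_definite (homogeneous_part (Im_fps2 \<phi>) (2 * L))"
    unfolding positive_definite_def
  proof (intro allI impI)
    fix x y :: real assume "x\<^sup>2 + y\<^sup>2 = 1"
    then consider "x \<noteq> 0" | "y \<noteq> 0" by force
    then show "poly2 (homogeneous_part (Im_fps2 \<phi>) (2 * L)) x y > 0"
      unfolding eval by cases (auto intro: add_pos_nonneg add_nonneg_pos simp: zero_less_power_eq)
  qed
  have "poly2 (homogeneous_part (Im_fps2 \<phi>) (2 * L)) 1 0 \<noteq> 0"
    using L by (simp add: eval power_0_left)
  then have "homogeneous_part (Im_fps2 \<phi>) (2 * L) \<noteq> 0"
    by (auto simp: poly2_def)
  moreover have "homogeneous_part (Im_fps2 \<phi>) m = 0" if "m < 2 * L" for m
  proof (cases "m = 0")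
    case True
    have "fps2_nth (Im_fps2 \<phi>) 0 0 = 0"
      using Im_pick_fps[of 0 L] L fps2_nth_separated_sum[of "pick_fps L" 0 0]
      by (simp add: \<phi>_def Im_fps2_def fps2_nth_def)
    with True show ?thesis by (simp add: homogeneous_part_def)
  next
    case False
    with that show ?thesis
      by (simp add: \<phi>_def homogeneous_part_Im_separated_sum Im_pick_fps)
  qed
  ultimately show ?thesis
    using posdef deriv by (intro exI[of _ p]) (auto simp: series vanishes_to_order_def)
qed

end
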